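(* For every infinite compact topological space $Y$, the relation $\omega^{*}\rightarrow(Y)^{1}_{2}$ fails.
   Context: $\omega$ is the countably infinite discrete space, $\beta(\omega)$ its Stone-Čech compactification, and $\omega^{*}=\beta(\omega)\setminus\omega$ with the subspace topology. For topological spaces $X,Y$, the relation $X\rightarrow(Y)^{1}_{2}$ means: whenever $X=P_0\cup P_1$, there are $i\in\{0,1\}$ and $Y'\subseteq P_i$ such that $Y'$ (with the subspace topology from $X$) is homeomorphic to $Y$. *)

theory Defs
  imports "HOL-Analysis.Analysis"
begin

text \<open>Cech's construction: a space \<open>X\<close> is mapped into the cube \<open>[0,1]\<^bsup>C(X,[0,1])\<^esup>\<close> by evaluation,
  and \<open>\<beta>(X)\<close> is the closure of the image. Extensionality makes each continuous map on the carrier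
  of \<open>X\<close> occur exactly once as a coordinate.\<close>

definition unit_maps :: "'a topology \<Rightarrow> ('a \<Rightarrow> real) set" where
  "unit_maps X =
     {f. continuous_map X (top_of_set {0..1::real}) f \<and> f \<in> extensional (topspace X)}"

definition stone_cech_map :: "'a topology \<Rightarrow> 'a \<Rightarrow> (('a \<Rightarrow> real) \<Rightarrow> real)" where
  "stone_cech_map X x = (\<lambda>f\<in>unit_maps X. f x)"

definition stone_cech :: "'a topology \<Rightarrow> (('a \<Rightarrow> real) \<Rightarrow> real) topology" where
  "stone_cech X =
     (let cube = product_topology (\<lambda>_. top_of_set {0..1::real}) (unit_maps X)
      in subtopology cube (cube closure_of (stone_cech_map X ` topspace X)))"

definition stone_cech_remainder :: "'a topology \<Rightarrow> (('a \<Rightarrow> real) \<Rightarrow> real) topology" where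
  "stone_cech_remainder X =
     subtopology (stone_cech X) (topspace (stone_cech X) - stone_cech_map X ` topspace X)"

definition omega_star :: "((nat \<Rightarrow> real) \<Rightarrow> real) topology" where
  "omega_star = stone_cech_remainder (discrete_topology (UNIV :: nat set))"

text \<open>The partition relation \<open>X \<rightarrow> (Y)\<^sup>1\<^sub>2\<close>; the two pieces need not be disjoint.\<close>

definition arrows_1_2 :: "'a topology \<Rightarrow> 'b topology \<Rightarrow> bool" where
  "arrows_1_2 X Y \<longleftrightarrow>
     (\<forall>P :: nat \<Rightarrow> 'a set. topspace X = P 0 \<union> P 1 \<longrightarrow>
        (\<exists>i\<in>{0, 1}. \<exists>Y'. Y' \<subseteq> P i \<and> subtopology X Y' homeomorphic_space Y))"

end

theory Submission
  imports Defs
begin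

text \<open>A copy of \<open>Y\<close> in \<open>\<omega>\<^sup>*\<close> is an infinite closed subset \<open>K\<close> of \<open>\<beta>(\<omega>)\<close>. Such a \<open>K\<close> contains a
  sequence \<open>d\<close> whose terms lie in the closures of pairwise disjoint subsets of \<open>\<omega>\<close>. Since disjoint
  subsets of \<open>\<omega>\<close> have disjoint closures in \<open>\<beta>(\<omega>)\<close>, the continuous extension of \<open>d\<close> to \<open>\<beta>(\<omega>)\<close> is
  injective, so the closure of the range of \<open>d\<close>, which is contained in \<open>K\<close>, has cardinality
  \<open>\<kappa> = |\<beta>(\<omega>)|\<close>. There are at most \<open>\<kappa>\<close> sequences in \<open>\<beta>(\<omega>)\<close>: the power \<open>\<beta>(\<omega>)\<^bsup>\<omega>\<^esup>\<close> is a separable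
  compact Hausdorff space, hence a continuous image of \<open>\<beta>(\<omega>)\<close>. So some set \<open>B\<close> splits every
  closure of size \<open>\<kappa>\<close> of a sequence, and neither \<open>B\<close> nor its complement contains \<open>K\<close>.\<close>

unbundle cardinal_syntax

section \<open>Bernstein sets\<close>

lemma distinct_representatives:
  assumes le: "\<And>i. i \<in> I \<Longrightarrow> |I| \<le>o |A i|"
  obtains f where "inj_on f I" "\<And>i. i \<in> I \<Longrightarrow> f i \<in> A i"
proof -
  let ?r = "|I|"
  have "Well_order ?r" by (rule card_of_Well_order)
  then have wf: "wf (?r - Id)" and total: "total_on I ?r"
    by (simp_all add: well_order_on_def linear_order_on_def Field_card_of)
  define fresh where "fresh f i x \<longleftrightarrow> (i \<in> I \<longrightarrow> x \<in> A i - f ` underS ?r i)" for f i x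
  have "\<exists>f. \<forall>i. fresh f i (f i)"
  proof (rule dependent_wf_choice[OF wf])
    fix f g :: "'a \<Rightarrow> 'b" and i x
    assume "\<And>j. (j, i) \<in> ?r - Id \<Longrightarrow> f j = g j"
    then have "f ` underS ?r i = g ` underS ?r i"
      by (intro image_cong) (auto simp: underS_def)
    then show "fresh f i x = fresh g i x" by (simp add: fresh_def)
  next
    fix i and f :: "'a \<Rightarrow> 'b"
    show "\<exists>x. fresh f i x"
    proof (cases "i \<in> I")
      case True
      have "|f ` underS ?r i| \<le>o |underS ?r i|" by (rule card_of_image)
      also have "|underS ?r i| <o ?r"
        using True by (intro card_of_underS card_of_Card_order) (simp add: Field_card_of)
      also have "?r \<le>o |A i|" using True by (rule le)
      finally have "\<not> A i \<subseteq> f ` underS ?r i"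
        using card_of_mono1 not_ordLess_ordLeq by blast
      then show ?thesis by (auto simp: fresh_def)
    qed (simp add: fresh_def)
  qed
  then obtain f where f: "\<And>i. fresh f i (f i)" by blast
  have "f i \<noteq> f j" if "i \<in> I" "j \<in> I" "i \<noteq> j" for i j
  proof -
    have "i \<in> underS ?r j \<or> j \<in> underS ?r i"
      using total that by (auto simp: total_on_def underS_def)
    then show ?thesis using f[of i] f[of j] that by (metis DiffE fresh_def imageI)
  qed
  with f show ?thesis by (intro that[of f]) (auto simp: inj_on_def fresh_def)
qed

lemma Bernstein_set:
  assumes "\<And>A. A \<in> \<A> \<Longrightarrow> infinite A" and "\<And>A. A \<in> \<A> \<Longrightarrow> |\<A>| \<le>o |A|"
  obtains B where "\<And>A. A \<in> \<A> \<Longrightarrow> A \<inter> B \<noteq> {} \<and> A - B \<noteq> {}"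
proof -
  have "|\<A> <+> \<A>| \<le>o |case_sum id id i|" if "i \<in> \<A> <+> \<A>" for i
  proof -
    have "case_sum id id i \<in> \<A>" using that by auto
    then show ?thesis
      using assms
      by (intro card_of_Plus_ordLeq_infinite_Field card_of_Card_order) (simp_all add: Field_card_of)
  qed
  then obtain f where inj: "inj_on f (\<A> <+> \<A>)"
      and mem: "\<And>i. i \<in> \<A> <+> \<A> \<Longrightarrow> f i \<in> case_sum id id i"
    using distinct_representatives by blast
  show ?thesis
  proof (rule that[of "f ` Inl ` \<A>"])
    fix A assume A: "A \<in> \<A>"
    have "f (Inr A) \<notin> f ` Inl ` \<A>"
      using inj A by (auto simp: inj_on_def)
    moreover have "f (Inr A) \<in> A" "f (Inl A) \<in> A" using mem A by fastforce+
    ultimately show "A \<inter> f ` Inl ` \<A> \<noteq> {} \<and> A - f ` Inl ` \<A> \<noteq> {}" using A by blast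
  qed
qed

section \<open>Separation and density\<close>

lemma regular_Hausdorff_disjoint_closures:
  assumes "regular_space X" "Hausdorff_space X" and xy: "x \<in> topspace X" "y \<in> topspace X" "x \<noteq> y"
  obtains U V where "openin X U" "x \<in> U" "openin X V" "y \<in> V" "X closure_of U \<inter> X closure_of V = {}"
proof -
  have "closedin X {x}" using assms by (simp add: closedin_Hausdorff_singleton)
  then obtain V where V: "openin X V" "y \<in> V" "x \<notin> X closure_of V"
    using assms(1) xy unfolding regular_space by (metis Diff_iff disjnt_insert1 singletonD)
  then obtain U where "openin X U" "x \<in> U" "disjnt (X closure_of V) (X closure_of U)"
    using assms(1) xy(1) unfolding regular_space by (metis DiffI closedin_closure_of)
  with V that show ?thesis by (auto simp: disjnt_def)
qed

lemma regular_Hausdorff_split_off_point: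
  assumes X: "regular_space X" "Hausdorff_space X" and "S \<subseteq> topspace X"
    and W: "openin X W" "infinite (S \<inter> W)"
  obtains U V d where "openin X U" "openin X V" "U \<subseteq> W" "V \<subseteq> W" "U \<inter> V = {}"
    "d \<in> S \<inter> U" "infinite (S \<inter> V)"
proof -
  obtain x where x: "x \<in> S \<inter> W" using W(2) infinite_imp_nonempty by blast
  obtain y where y: "y \<in> S \<inter> W" "y \<noteq> x" using W(2) finite_subset[of "S \<inter> W" "{x}"] by blast
  obtain G H where GH: "openin X G" "x \<in> G" "openin X H" "y \<in> H"
      "X closure_of G \<inter> X closure_of H = {}"
    using regular_Hausdorff_disjoint_closures[OF X, of x y] x y assms(3) by blast
  then have "S \<inter> W = S \<inter> (W - X closure_of G) \<union> S \<inter> (W - X closure_of H)" by blast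
  then have "infinite (S \<inter> (W - X closure_of G)) \<or> infinite (S \<inter> (W - X closure_of H))"
    using W(2) by (metis finite_UnI)
  then obtain z E where z: "z \<in> S \<inter> W" "z \<in> E" and E: "openin X E"
      and inf: "infinite (S \<inter> (W - X closure_of E))"
    using x y(1) GH by blast
  show ?thesis
  proof (rule that[of "W \<inter> E" "W - X closure_of E" z])
    show "openin X (W - X closure_of E)" by (simp add: W(1) openin_diff)
    show "W \<inter> E \<inter> (W - X closure_of E) = {}"
      using closure_of_subset[OF openin_subset[OF E]] by blast
  qed (use z E inf W(1) in auto)
qed

lemma regular_Hausdorff_separated_sequence:
  assumes X: "regular_space X" "Hausdorff_space X" and S: "S \<subseteq> topspace X" "infinite S"
  obtains d U where "\<And>n::nat. openin X (U n)" "disjoint_family U" "\<And>n. d n \<in> S \<inter> U n"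
proof -
  define splits where "splits W W' U d \<longleftrightarrow>
    openin X U \<and> U \<subseteq> W \<and> W' \<subseteq> W \<and> U \<inter> W' = {} \<and> d \<in> S \<inter> U" for W W' U d
  have "\<exists>W. \<forall>n. (openin X (W n) \<and> infinite (S \<inter> W n)) \<and> (\<exists>U d. splits (W n) (W (Suc n)) U d)"
  proof (rule dependent_nat_choice)
    have "S \<inter> topspace X = S" using S(1) by blast
    then show "\<exists>W. openin X W \<and> infinite (S \<inter> W)" using S(2) by (metis openin_topspace)
  next
    fix W and n :: nat
    assume "openin X W \<and> infinite (S \<inter> W)"
    then obtain U W' d where "openin X U" "openin X W'" "U \<subseteq> W" "W' \<subseteq> W" "U \<inter> W' = {}"
        "d \<in> S \<inter> U" "infinite (S \<inter> W')"
      using regular_Hausdorff_split_off_point[OF X S(1)] by metis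
    then show "\<exists>W'. (openin X W' \<and> infinite (S \<inter> W')) \<and> (\<exists>U d. splits W W' U d)"
      unfolding splits_def by blast
  qed
  then obtain W where "\<And>n. \<exists>U d. splits (W n) (W (Suc n)) U d" by blast
  then obtain U d where splits: "\<And>n. splits (W n) (W (Suc n)) (U n) (d n)" by metis
  have "U m \<inter> U n = {}" if "m < n" for m n
  proof -
    have "W n \<subseteq> W (Suc m)"
      by (rule lift_Suc_antimono_le) (use splits that in \<open>auto simp: splits_def\<close>)
    then show ?thesis using splits[of m] splits[of n] by (auto simp: splits_def)
  qed
  then have "disjoint_family U"
    unfolding disjoint_family_on_def by (metis inf_commute nat_neq_iff)
  then show ?thesis using splits by (intro that[of U d]) (auto simp: splits_def)
qed

lemma dense_subset_separates:
  assumes "Hausdorff_space X" and dense: "X closure_of D = topspace X"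
    and xy: "x \<in> topspace X" "y \<in> topspace X" "x \<noteq> y"
  obtains C where "C \<subseteq> D" "x \<in> X closure_of C" "y \<in> X closure_of (D - C)"
proof -
  obtain U V where UV: "openin X U" "openin X V" "x \<in> U" "y \<in> V" "disjnt U V"
    using assms unfolding Hausdorff_space_def by metis
  have "x \<in> X closure_of (U \<inter> D)" "y \<in> X closure_of (V \<inter> D)"
    using openin_Int_closure_of_subset[of X] UV dense xy by blast+
  moreover have "V \<inter> D \<subseteq> D - U \<inter> D" using UV(5) by (auto simp: disjnt_iff)
  ultimately show ?thesis
    by (intro that[of "U \<inter> D"]) (use closure_of_mono in blast)+
qed

lemma continuous_map_image_closure_indexed:
  assumes g: "continuous_map X Y g" and mem: "\<And>i. i \<in> I \<Longrightarrow> g (h i) \<in> Y closure_of T i"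
  shows "g ` (X closure_of (h ` I)) \<subseteq> Y closure_of (\<Union>i\<in>I. T i)"
proof -
  have "g ` h ` I \<subseteq> Y closure_of (\<Union>i\<in>I. T i)"
  proof clarify
    fix i assume "i \<in> I"
    then have "Y closure_of T i \<subseteq> Y closure_of (\<Union>i\<in>I. T i)" by (intro closure_of_mono) blast
    then show "g (h i) \<in> Y closure_of (\<Union>i\<in>I. T i)" using mem[OF \<open>i \<in> I\<close>] by blast
  qed
  then have "Y closure_of (g ` h ` I) \<subseteq> Y closure_of (\<Union>i\<in>I. T i)"
    by (simp add: closure_of_minimal)
  then show ?thesis using continuous_map_image_closure_subset[OF g] by blast
qed

lemma continuous_map_dense_image_surj:
  assumes f: "continuous_map X Y f" and "compact_space X" "Hausdorff_space Y"
    and dense: "Y closure_of (f ` topspace X) = topspace Y"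
  shows "f ` topspace X = topspace Y"
proof -
  have "compactin Y (f ` topspace X)"
    using assms(2) image_compactin[OF _ f] by (simp add: compact_space_def)
  then have "closedin Y (f ` topspace X)"
    by (rule compactin_imp_closedin[OF assms(3)])
  then show ?thesis using dense by (simp add: closure_of_closedin)
qed

lemma homeomorphic_copy_compactin_infinite:
  assumes "K \<subseteq> topspace X" "subtopology X K homeomorphic_space Y"
    and "compact_space Y" "infinite (topspace Y)"
  shows "compactin X K" "infinite K"
proof -
  show "compactin X K"
    using assms homeomorphic_compact_space by (auto simp: compactin_subspace)
  obtain h where "homeomorphic_map (subtopology X K) Y h"
    using assms(2) homeomorphic_space by blast
  then have "h ` K = topspace Y"
    using assms(1) homeomorphic_imp_surjective_map by (metis topspace_subtopology_subset)
  then show "infinite K" using assms(4) finite_imageI by metis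
qed

section \<open>Countable products of separable spaces\<close>

lemma countable_PiE_finite_modifications:
  assumes "countable I" and "\<And>i. i \<in> I \<Longrightarrow> countable (C i)"
  shows "countable {x \<in> PiE I C. finite {i \<in> I. x i \<noteq> z i}}" (is "countable ?D")
proof (rule countable_subset)
  let ?modify = "\<lambda>F f. \<lambda>i\<in>I. if i \<in> F then f i else z i"
  show "?D \<subseteq> (\<Union>F\<in>Fpow I. ?modify F ` PiE F C)"
  proof
    fix x assume x: "x \<in> ?D"
    let ?F = "{i \<in> I. x i \<noteq> z i}"
    have "x = ?modify ?F (restrict x ?F)"
      using x by (auto simp: PiE_iff extensional_def fun_eq_iff)
    moreover have "restrict x ?F \<in> PiE ?F C" "?F \<in> Fpow I"
      using x by (auto simp: Fpow_def)
    ultimately show "x \<in> (\<Union>F\<in>Fpow I. ?modify F ` PiE F C)" by blast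
  qed
  show "countable (\<Union>F\<in>Fpow I. ?modify F ` PiE F C)"
    using assms
    by (intro countable_UN countable_image countable_PiE countable_Fpow) (auto simp: Fpow_def)
qed

lemma dense_PiE_finite_modifications:
  assumes dense: "\<And>i. i \<in> I \<Longrightarrow> X i closure_of C i = topspace (X i)"
    and z: "z \<in> PiE I C" "z \<in> topspace (product_topology X I)"
  shows "product_topology X I closure_of {x \<in> PiE I C. finite {i \<in> I. x i \<noteq> z i}}
    = topspace (product_topology X I)" (is "_ closure_of ?D = _")
proof (intro subset_antisym closure_of_subset_topspace subsetI)
  fix x assume x: "x \<in> topspace (product_topology X I)"
  show "x \<in> product_topology X I closure_of ?D"
    unfolding in_closure_of
  proof (intro conjI allI impI x)
    fix T assume "x \<in> T \<and> openin (product_topology X I) T"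
    then obtain U where U: "finite {i \<in> I. U i \<noteq> topspace (X i)}" "\<And>i. i \<in> I \<Longrightarrow> openin (X i) (U i)"
        "x \<in> PiE I U" "PiE I U \<subseteq> T"
      unfolding openin_product_topology_alt by metis
    have "\<exists>c. c \<in> C i \<inter> U i" if "i \<in> I" for i
      using openin_Int_closure_of_eq_empty[of "X i" "U i" "C i"] U(2,3) dense that x by fastforce
    then obtain c where c: "\<And>i. i \<in> I \<Longrightarrow> c i \<in> C i \<inter> U i" by metis
    define y where "y = (\<lambda>i\<in>I. if U i = topspace (X i) then z i else c i)"
    have "finite {i \<in> I. y i \<noteq> z i}"
      by (rule finite_subset[OF _ U(1)]) (auto simp: y_def)
    then have "y \<in> ?D" using c z(1) by (auto simp: y_def PiE_iff)
    moreover have "y \<in> PiE I U" using c z(2) by (auto simp: y_def PiE_iff)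
    ultimately show "\<exists>y. y \<in> ?D \<and> y \<in> T" using U(4) by blast
  qed
qed

lemma separable_space_product_topology:
  assumes I: "countable I" and sep: "\<And>i. i \<in> I \<Longrightarrow> separable_space (X i)"
  shows "separable_space (product_topology X I)"
proof (cases "topspace (product_topology X I) = {}")
  case True
  then show ?thesis unfolding separable_space_def by (intro exI[of _ "{}"]) simp
next
  case False
  obtain C where C: "\<And>i. i \<in> I \<Longrightarrow> countable (C i)" "\<And>i. i \<in> I \<Longrightarrow> C i \<subseteq> topspace (X i)"
      and dense: "\<And>i. i \<in> I \<Longrightarrow> X i closure_of C i = topspace (X i)"
    using sep unfolding separable_space_def by metis
  have "C i \<noteq> {}" if "i \<in> I" for i
    using dense[OF that] False that closure_of_empty[of "X i"]
    by (metis PiE_eq_empty_iff topspace_product_topology)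
  then obtain z where z: "z \<in> PiE I C" by (metis PiE_eq_empty_iff all_not_in_conv)
  have sub: "PiE I C \<subseteq> topspace (product_topology X I)" using C(2) by (simp add: PiE_mono)
  let ?D = "{x \<in> PiE I C. finite {i \<in> I. x i \<noteq> z i}}"
  have "countable ?D" using I C(1) by (rule countable_PiE_finite_modifications)
  moreover have "product_topology X I closure_of ?D = topspace (product_topology X I)"
    by (rule dense_PiE_finite_modifications) (use dense z sub in blast)+
  ultimately show ?thesis unfolding separable_space_def using sub by blast
qed

section \<open>The Stone-Cech compactification\<close>

abbreviation unit_map_cube :: "'a topology \<Rightarrow> (('a \<Rightarrow> real) \<Rightarrow> real) topology" where
  "unit_map_cube X \<equiv> product_topology (\<lambda>_. top_of_set {0..1}) (unit_maps X)"

lemma stone_cech_eq_closure: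
  "stone_cech X = subtopology (unit_map_cube X)
     (unit_map_cube X closure_of (stone_cech_map X ` topspace X))"
  by (simp add: stone_cech_def Let_def)

lemma continuous_map_stone_cech_map_cube: "continuous_map X (unit_map_cube X) (stone_cech_map X)"
proof -
  have "continuous_map X (top_of_set {0..1}) (\<lambda>x. stone_cech_map X x f)" if "f \<in> unit_maps X" for f
    using that by (simp add: stone_cech_map_def unit_maps_def)
  then show ?thesis
    by (auto simp: continuous_map_componentwise stone_cech_map_def)
qed

lemma stone_cech_map_image_subset_cube: "stone_cech_map X ` topspace X \<subseteq> topspace (unit_map_cube X)"
  by (rule continuous_map_image_subset_topspace[OF continuous_map_stone_cech_map_cube])

lemma continuous_map_stone_cech_map: "continuous_map X (stone_cech X) (stone_cech_map X)"
  unfolding stone_cech_eq_closure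
  using continuous_map_stone_cech_map_cube[of X]
    closure_of_subset[OF stone_cech_map_image_subset_cube[of X]]
  by (auto simp: continuous_map_in_subtopology simp del: topspace_product_topology)

lemma stone_cech_map_dense:
  "stone_cech X closure_of (stone_cech_map X ` topspace X) = topspace (stone_cech X)"
  unfolding stone_cech_eq_closure
  using closure_of_subset[OF stone_cech_map_image_subset_cube[of X]]
  by (simp add: closure_of_subtopology inf_absorb2 topspace_subtopology_subset
      closure_of_subset_topspace
      del: topspace_product_topology topspace_subtopology)

lemma compact_space_stone_cech: "compact_space (stone_cech X)"
  unfolding stone_cech_eq_closure
  by (intro compact_space_subtopology closedin_compact_space)
    (simp_all add: compact_space_product_topology compact_space_subtopology)

lemma Hausdorff_space_stone_cech: "Hausdorff_space (stone_cech X)"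
  unfolding stone_cech_eq_closure
  by (simp add: Hausdorff_space_subtopology Hausdorff_space_product_topology)

lemma regular_space_stone_cech: "regular_space (stone_cech X)"
  by (intro compact_Hausdorff_imp_regular_space compact_space_stone_cech Hausdorff_space_stone_cech)

lemma separable_space_stone_cech:
  assumes "separable_space X"
  shows "separable_space (stone_cech X)"
proof -
  obtain C where C: "countable C" "C \<subseteq> topspace X" "X closure_of C = topspace X"
    using assms unfolding separable_space_def by blast
  have "stone_cech_map X ` topspace X \<subseteq> stone_cech X closure_of (stone_cech_map X ` C)"
    using continuous_map_image_closure_subset[OF continuous_map_stone_cech_map, of X C] C(3) by simp
  then have "topspace (stone_cech X) \<subseteq> stone_cech X closure_of (stone_cech_map X ` C)"
    by (metis closedin_closure_of closure_of_minimal stone_cech_map_dense)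
  moreover have "stone_cech_map X ` C \<subseteq> topspace (stone_cech X)"
    using C(2) continuous_map_image_subset_topspace[OF continuous_map_stone_cech_map, of X] by blast
  ultimately show ?thesis
    unfolding separable_space_def using C(1)
    by (meson closure_of_subset_topspace countable_image subset_antisym)
qed

lemma inj_on_stone_cech_map:
  assumes "completely_regular_space X" "Hausdorff_space X"
  shows "inj_on (stone_cech_map X) (topspace X)"
proof (rule inj_onI, rule ccontr)
  fix x y assume x: "x \<in> topspace X" and y: "y \<in> topspace X" and "x \<noteq> y"
    and eq: "stone_cech_map X x = stone_cech_map X y"
  have "closedin X {y}" using assms(2) y by (simp add: closedin_Hausdorff_singleton)
  then obtain f where f: "continuous_map X (top_of_set {0..1::real}) f" "f x = 0" "f y = 1"
    using assms(1) x \<open>x \<noteq> y\<close> unfolding completely_regular_space_def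
    by (metis DiffI image_subset_iff insertI1 singletonD)
  have "restrict f (topspace X) \<in> unit_maps X"
    using f(1) continuous_map_eq[OF f(1), of "restrict f (topspace X)"] by (simp add: unit_maps_def)
  with fun_cong[OF eq, of "restrict f (topspace X)"] have "f x = f y"
    using x y by (simp add: stone_cech_map_def)
  with f show False by simp
qed

lemma stone_cech_functorial:
  assumes f: "continuous_map X Y f"
  obtains F where "continuous_map (stone_cech X) (stone_cech Y) F"
    "\<And>x. x \<in> topspace X \<Longrightarrow> F (stone_cech_map X x) = stone_cech_map Y (f x)"
proof
  define pullback where "pullback g = (\<lambda>x\<in>topspace X. g (f x))" for g :: "'b \<Rightarrow> real"
  define F where "F p = (\<lambda>g\<in>unit_maps Y. p (pullback g))" for p :: "('a \<Rightarrow> real) \<Rightarrow> real"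
  have pullback: "pullback g \<in> unit_maps X" if "g \<in> unit_maps Y" for g
  proof -
    have "continuous_map X (top_of_set {0..1}) (g \<circ> f)"
      using that f by (auto simp: unit_maps_def intro: continuous_map_compose)
    then show ?thesis
      by (auto simp: unit_maps_def pullback_def intro: continuous_map_eq)
  qed
  show F_map: "F (stone_cech_map X x) = stone_cech_map Y (f x)" if "x \<in> topspace X" for x
    using that pullback by (auto simp: F_def stone_cech_map_def pullback_def)
  have cube: "continuous_map (unit_map_cube X) (unit_map_cube Y) F"
    unfolding continuous_map_componentwise
  proof (intro conjI ballI)
    fix g assume g: "g \<in> unit_maps Y"
    then have "(\<lambda>p. F p g) = (\<lambda>p. p (pullback g))" by (simp add: F_def)
    then show "continuous_map (unit_map_cube X) (top_of_set {0..1}) (\<lambda>p. F p g)"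
      using continuous_map_product_projection[OF pullback[OF g]] by metis
  qed (auto simp: F_def)
  have "F ` (unit_map_cube X closure_of (stone_cech_map X ` topspace X))
      \<subseteq> unit_map_cube Y closure_of (F ` stone_cech_map X ` topspace X)"
    by (rule continuous_map_image_closure_subset[OF cube])
  also have "\<dots> \<subseteq> unit_map_cube Y closure_of (stone_cech_map Y ` topspace Y)"
    using F_map continuous_map_image_subset_topspace[OF f] by (intro closure_of_mono) auto
  finally show "continuous_map (stone_cech X) (stone_cech Y) F"
    unfolding stone_cech_eq_closure
    by (auto simp: continuous_map_in_subtopology intro: continuous_map_from_subtopology[OF cube])
qed

lemma homeomorphic_map_stone_cech_map:
  assumes "compact_space X" "Hausdorff_space X"
  shows "homeomorphic_map X (stone_cech X) (stone_cech_map X)"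
proof (rule continuous_imp_homeomorphic_map)
  show "stone_cech_map X ` topspace X = topspace (stone_cech X)"
    by (rule continuous_map_dense_image_surj[OF continuous_map_stone_cech_map assms(1)
          Hausdorff_space_stone_cech stone_cech_map_dense])
  show "inj_on (stone_cech_map X) (topspace X)"
    using assms by (simp add: inj_on_stone_cech_map normal_imp_completely_regular_space
        compact_Hausdorff_or_regular_imp_normal_space)
qed (use assms in \<open>simp_all add: continuous_map_stone_cech_map Hausdorff_space_stone_cech\<close>)

theorem stone_cech_extension:
  assumes "continuous_map X Z f" "compact_space Z" "Hausdorff_space Z"
  obtains g where "continuous_map (stone_cech X) Z g"
    "\<And>x. x \<in> topspace X \<Longrightarrow> g (stone_cech_map X x) = f x"
proof -
  obtain F where F: "continuous_map (stone_cech X) (stone_cech Z) F"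
      "\<And>x. x \<in> topspace X \<Longrightarrow> F (stone_cech_map X x) = stone_cech_map Z (f x)"
    using stone_cech_functorial[OF assms(1)] by blast
  obtain r where r: "homeomorphic_maps Z (stone_cech Z) (stone_cech_map Z) r"
    using homeomorphic_map_stone_cech_map[OF assms(2,3)] homeomorphic_map_maps by blast
  show ?thesis
  proof (rule that[of "r \<circ> F"])
    show "continuous_map (stone_cech X) Z (r \<circ> F)"
      using F(1) r by (auto simp: homeomorphic_maps_def intro: continuous_map_compose)
    show "(r \<circ> F) (stone_cech_map X x) = f x" if "x \<in> topspace X" for x
      using that F(2) r continuous_map_image_subset_topspace[OF assms(1)]
      by (auto simp: homeomorphic_maps_def)
  qed
qed

corollary stone_cech_extension_surj:
  assumes f: "continuous_map X Z f" and Z: "compact_space Z" "Hausdorff_space Z"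
    and dense: "Z closure_of (f ` topspace X) = topspace Z"
  obtains g where "continuous_map (stone_cech X) Z g" "g ` topspace (stone_cech X) = topspace Z"
proof -
  obtain g where g: "continuous_map (stone_cech X) Z g"
      "\<And>x. x \<in> topspace X \<Longrightarrow> g (stone_cech_map X x) = f x"
    using stone_cech_extension[OF f Z] by blast
  have "f ` topspace X \<subseteq> g ` topspace (stone_cech X)"
    using g(2) continuous_map_image_subset_topspace[OF continuous_map_stone_cech_map, of X] by force
  then have "topspace Z \<subseteq> Z closure_of (g ` topspace (stone_cech X))"
    using dense closure_of_mono by metis
  then have "g ` topspace (stone_cech X) = topspace Z"
    by (intro continuous_map_dense_image_surj[OF g(1) compact_space_stone_cech Z(2)]
        subset_antisym closure_of_subset_topspace)
  with g(1) show ?thesis by (rule that)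
qed

section \<open>The Stone-Cech compactification of a discrete space\<close>

lemma stone_cech_discrete_closures_disjoint:
  fixes U :: "'a set"
  defines "X \<equiv> discrete_topology U"
  assumes "A \<subseteq> U" "B \<subseteq> U" "A \<inter> B = {}"
  shows "stone_cech X closure_of (stone_cech_map X ` A)
    \<inter> stone_cech X closure_of (stone_cech_map X ` B) = {}"
proof -
  have "compact_space (discrete_topology (UNIV :: bool set))"
    by (simp add: compact_space_discrete_topology)
  then obtain g where g: "continuous_map (stone_cech X) (discrete_topology UNIV) g"
      "\<And>x. x \<in> U \<Longrightarrow> g (stone_cech_map X x) \<longleftrightarrow> x \<in> A"
    using stone_cech_extension[of X "discrete_topology UNIV" "\<lambda>x. x \<in> A"] by (auto simp: X_def)
  have value_on_closure: "g p = b" if p: "p \<in> stone_cech X closure_of (stone_cech_map X ` C)"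
      and C: "C \<subseteq> U" "\<And>x. x \<in> C \<Longrightarrow> x \<in> A \<longleftrightarrow> b" for p C b
  proof (rule forall_in_closure_of[OF p])
    show "g q = b" if "q \<in> stone_cech_map X ` C" for q
      using that g(2) C by auto
    show "closedin (stone_cech X) {q \<in> topspace (stone_cech X). g q = b}"
      using closedin_continuous_map_preimage[OF g(1), of "{b}"] by simp
  qed
  show ?thesis using value_on_closure[of _ A True] value_on_closure[of _ B False] assms by blast
qed

lemma inj_on_stone_cech_discrete:
  fixes U :: "'a set" and V :: "'b set"
  defines "X \<equiv> discrete_topology U" and "Y \<equiv> discrete_topology V"
  assumes g: "continuous_map (stone_cech X) (stone_cech Y) g"
    and A: "disjoint_family_on A U" "\<And>u. u \<in> U \<Longrightarrow> A u \<subseteq> V"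
    and mem: "\<And>u. u \<in> U \<Longrightarrow> g (stone_cech_map X u) \<in> stone_cech Y closure_of (stone_cech_map Y ` A u)"
  shows "inj_on g (topspace (stone_cech X))"
proof (rule inj_onI, rule ccontr)
  fix p q assume pq: "p \<in> topspace (stone_cech X)" "q \<in> topspace (stone_cech X)" "p \<noteq> q"
    and eq: "g p = g q"
  have "stone_cech X closure_of (stone_cech_map X ` U) = topspace (stone_cech X)"
    using stone_cech_map_dense[of X] by (simp add: X_def)
  then obtain E where "E \<subseteq> stone_cech_map X ` U" "p \<in> stone_cech X closure_of E"
      "q \<in> stone_cech X closure_of (stone_cech_map X ` U - E)"
    using dense_subset_separates[OF Hausdorff_space_stone_cech _ pq] by metis
  moreover define C where "C = {u \<in> U. stone_cech_map X u \<in> E}"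
  ultimately have C: "p \<in> stone_cech X closure_of (stone_cech_map X ` C)"
      "q \<in> stone_cech X closure_of (stone_cech_map X ` (U - C))"
    by (auto elim!: subsetD[OF closure_of_mono, rotated])
  have image: "g ` (stone_cech X closure_of (stone_cech_map X ` D))
      \<subseteq> stone_cech Y closure_of (stone_cech_map Y ` \<Union> (A ` D))" if "D \<subseteq> U" for D
    using continuous_map_image_closure_indexed[OF g, of D "stone_cech_map X"] mem that
    by (simp add: image_UN subset_iff)
  have "\<Union> (A ` C) \<inter> \<Union> (A ` (U - C)) = {}"
    using A(1) by (fastforce simp: C_def disjoint_family_on_def)
  then have "stone_cech Y closure_of (stone_cech_map Y ` \<Union> (A ` C))
      \<inter> stone_cech Y closure_of (stone_cech_map Y ` \<Union> (A ` (U - C))) = {}"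
    unfolding Y_def using A(2) by (intro stone_cech_discrete_closures_disjoint) (auto simp: C_def)
  moreover have "C \<subseteq> U" by (auto simp: C_def)
  ultimately have "g p \<noteq> g q" using image[of C] image[of "U - C"] C by blast
  with eq show False by contradiction
qed

abbreviation beta_omega :: "((nat \<Rightarrow> real) \<Rightarrow> real) topology" where
  "beta_omega \<equiv> stone_cech (discrete_topology (UNIV :: nat set))"

lemma infinite_topspace_beta_omega: "infinite (topspace beta_omega)"
proof -
  have "inj_on (stone_cech_map (discrete_topology UNIV)) (UNIV :: nat set)"
    using inj_on_stone_cech_map[of "discrete_topology (UNIV :: nat set)"]
    by (simp add: completely_regular_space_discrete_topology)
  moreover have "range (stone_cech_map (discrete_topology (UNIV :: nat set))) \<subseteq> topspace beta_omega"
    using continuous_map_image_subset_topspace[OF continuous_map_stone_cech_map]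
    by (metis topspace_discrete_topology)
  ultimately show ?thesis using finite_subset range_inj_infinite by blast
qed

lemma card_of_separable_compact_Hausdorff_ordLeq:
  assumes "separable_space Z" "compact_space Z" "Hausdorff_space Z"
  shows "|topspace Z| \<le>o |topspace beta_omega|"
proof (cases "topspace Z = {}")
  case False
  obtain C where C: "countable C" "C \<subseteq> topspace Z" "Z closure_of C = topspace Z"
    using assms(1) unfolding separable_space_def by blast
  with False have "C \<noteq> {}" by (metis closure_of_empty)
  with C have range: "range (from_nat_into C) = C" by simp
  then have "continuous_map (discrete_topology (UNIV :: nat set)) Z (from_nat_into C)"
    using C(2) by auto
  then obtain g where "g ` topspace beta_omega = topspace Z"
    using stone_cech_extension_surj[OF _ assms(2,3)] C(3) range
    by (metis topspace_discrete_topology)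
  then show ?thesis by (metis card_of_image)
qed (simp add: card_of_empty)

lemma card_of_sequences_beta_omega_ordLeq:
  "|{d :: nat \<Rightarrow> _. range d \<subseteq> topspace beta_omega}| \<le>o |topspace beta_omega|"
proof -
  let ?Z = "product_topology (\<lambda>_::nat. beta_omega) UNIV"
  have "separable_space ?Z"
    by (intro separable_space_product_topology separable_space_stone_cech)
      (simp_all add: separable_space_discrete_topology)
  moreover have "compact_space ?Z" "Hausdorff_space ?Z"
    by (simp_all add: compact_space_product_topology Hausdorff_space_product_topology
        compact_space_stone_cech Hausdorff_space_stone_cech)
  moreover have "topspace ?Z = {d. range d \<subseteq> topspace beta_omega}" by auto
  ultimately show ?thesis using card_of_separable_compact_Hausdorff_ordLeq by metis
qed

lemma sequence_with_large_closure:
  fixes V :: "'a set"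
  defines "Y \<equiv> discrete_topology V"
  assumes "S \<subseteq> topspace (stone_cech Y)" "infinite S"
  obtains d :: "nat \<Rightarrow> _" where "range d \<subseteq> S"
    "|topspace beta_omega| \<le>o |stone_cech Y closure_of range d|"
proof -
  let ?\<omega> = "discrete_topology (UNIV :: nat set)"
  obtain d U where U: "\<And>n::nat. openin (stone_cech Y) (U n)" "disjoint_family U"
      and d: "\<And>n. d n \<in> S \<inter> U n"
    using regular_Hausdorff_separated_sequence
      [OF regular_space_stone_cech Hausdorff_space_stone_cech assms(2,3)] by metis
  have range: "range d \<subseteq> S" using d by blast
  then have "continuous_map ?\<omega> (stone_cech Y) d"
    using assms(2) by (simp add: Pi_iff image_subset_iff subset_iff)
  then obtain g where g: "continuous_map beta_omega (stone_cech Y) g"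
      "\<And>n. g (stone_cech_map ?\<omega> n) = d n"
    using stone_cech_extension[OF _ compact_space_stone_cech Hausdorff_space_stone_cech]
    by (metis UNIV_I topspace_discrete_topology)
  define A where "A n = {v \<in> V. stone_cech_map Y v \<in> U n}" for n
  have "d n \<in> stone_cech Y closure_of (stone_cech_map Y ` A n)" for n
  proof -
    have "d n \<in> stone_cech Y closure_of (U n \<inter> stone_cech_map Y ` V)"
      using openin_Int_closure_of_subset[OF U(1)] stone_cech_map_dense[of Y] d assms(2)
      by (fastforce simp: Y_def)
    moreover have "U n \<inter> stone_cech_map Y ` V = stone_cech_map Y ` A n" by (auto simp: A_def)
    ultimately show ?thesis by simp
  qed
  moreover have "disjoint_family A" using U(2) by (auto simp: A_def disjoint_family_on_def)
  ultimately have "inj_on g (topspace beta_omega)"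
    using g unfolding Y_def by (intro inj_on_stone_cech_discrete[where A = A]) (auto simp: A_def)
  moreover have "g ` topspace beta_omega \<subseteq> stone_cech Y closure_of range d"
    using continuous_map_image_closure_subset[OF g(1), of "range (stone_cech_map ?\<omega>)"]
      stone_cech_map_dense[of ?\<omega>] g(2) by (simp add: image_image)
  ultimately have "|topspace beta_omega| \<le>o |stone_cech Y closure_of range d|"
    using card_of_ordLeq by blast
  with range show ?thesis by (rule that)
qed

lemma Bernstein_set_beta_omega:
  obtains B where "\<And>K. closedin beta_omega K \<Longrightarrow> infinite K \<Longrightarrow> K \<inter> B \<noteq> {} \<and> K - B \<noteq> {}"
proof -
  define \<A> where "\<A> = {C. \<exists>d :: nat \<Rightarrow> _. range d \<subseteq> topspace beta_omega
    \<and> C = beta_omega closure_of range d \<and> |topspace beta_omega| \<le>o |C|}"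
  let ?sequences = "{d :: nat \<Rightarrow> _. range d \<subseteq> topspace beta_omega}"
  have "\<A> \<subseteq> (\<lambda>d. beta_omega closure_of range d) ` ?sequences" by (auto simp: \<A>_def)
  then have "|\<A>| \<le>o |?sequences|" by (rule surj_imp_ordLeq)
  then have card: "|\<A>| \<le>o |topspace beta_omega|"
    using card_of_sequences_beta_omega_ordLeq by (rule ordLeq_transitive)
  have "infinite C" "|\<A>| \<le>o |C|" if "C \<in> \<A>" for C
    using that card card_of_ordLeq_infinite infinite_topspace_beta_omega
    by (auto simp: \<A>_def intro: ordLeq_transitive)
  then obtain B where B: "\<And>C. C \<in> \<A> \<Longrightarrow> C \<inter> B \<noteq> {} \<and> C - B \<noteq> {}"
    using Bernstein_set[of \<A>] by blast
  show ?thesis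
  proof (rule that[of B])
    fix K assume K: "closedin beta_omega K" "infinite K"
    then have "K \<subseteq> topspace beta_omega" by (simp add: closedin_subset)
    then obtain d :: "nat \<Rightarrow> _" where d: "range d \<subseteq> K"
        "|topspace beta_omega| \<le>o |beta_omega closure_of range d|"
      using sequence_with_large_closure[of K] K(2) by blast
    then have "beta_omega closure_of range d \<in> \<A>"
      using \<open>K \<subseteq> _\<close> by (auto simp: \<A>_def)
    moreover have "beta_omega closure_of range d \<subseteq> K" using d(1) K(1) by (rule closure_of_minimal)
    ultimately show "K \<inter> B \<noteq> {} \<and> K - B \<noteq> {}" using B by blast
  qed
qed

theorem corollary2p3:
  fixes Y :: "'a topology"
  assumes "compact_space Y" and "infinite (topspace Y)"
  shows "\<not> arrows_1_2 omega_star Y"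
proof
  assume arrows: "arrows_1_2 omega_star Y"
  obtain B where B: "\<And>K. closedin beta_omega K \<Longrightarrow> infinite K \<Longrightarrow> K \<inter> B \<noteq> {} \<and> K - B \<noteq> {}"
    using Bernstein_set_beta_omega by blast
  define P :: "nat \<Rightarrow> _" where
    "P k = (if k = 0 then topspace omega_star \<inter> B else topspace omega_star - B)" for k
  have "topspace omega_star = P 0 \<union> P 1" by (auto simp: P_def)
  then obtain k K where K: "K \<subseteq> P k" "subtopology omega_star K homeomorphic_space Y"
    using arrows unfolding arrows_1_2_def by blast
  then have "K \<subseteq> topspace omega_star" by (auto simp: P_def split: if_splits)
  then have "compactin omega_star K" and inf: "infinite K"
    using homeomorphic_copy_compactin_infinite K(2) assms by blast+
  then have "compactin beta_omega K"
    by (simp add: omega_star_def stone_cech_remainder_def compactin_subtopology)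
  then have "closedin beta_omega K"
    by (rule compactin_imp_closedin[OF Hausdorff_space_stone_cech])
  with B inf K(1) show False by (fastforce simp: P_def split: if_splits)
qed

end
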